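(* Let $\mathcal A_1\in\mathbb C^{n_1\times m_1\times p}$, $\mathcal B_1\in\mathbb C^{n_1\times m_2\times p}$, $\mathcal C_1\in\mathbb C^{n_2\times m_1\times p}$, $\mathcal D_1\in\mathbb C^{n_2\times m_2\times p}$, $\mathcal A_2\in\mathbb C^{m_1\times r_1\times p}$, $\mathcal B_2\in\mathbb C^{m_1\times r_2\times p}$, $\mathcal C_2\in\mathbb C^{m_2\times r_1\times p}$ and $\mathcal D_2\in\mathbb C^{m_2\times r_2\times p}$ be complex tensors. Then $$\begin{bmatrix}\mathcal A_1&\mathcal B_1\\ \mathcal C_1&\mathcal D_1\end{bmatrix}*\begin{bmatrix}\mathcal A_2&\mathcal B_2\\ \mathcal C_2&\mathcal D_2\end{bmatrix}=\begin{bmatrix}\mathcal A_1*\mathcal A_2+\mathcal B_1*\mathcal C_2&\mathcal A_1*\mathcal B_2+\mathcal B_1*\mathcal D_2\\ \mathcal C_1*\mathcal A_2+\mathcal D_1*\mathcal C_2&\mathcal C_1*\mathcal B_2+\mathcal D_1*\mathcal D_2\end{bmatrix}.$$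
   Context: For $\mathcal A\in\mathbb C^{m\times n\times p}$ with frontal slices $A^{(1)},\dots,A^{(p)}\in\mathbb C^{m\times n}$, $\mathrm{unfold}(\mathcal A)\in\mathbb C^{mp\times n}$ is the vertical stack of $A^{(1)},\dots,A^{(p)}$, $\mathrm{fold}$ is its inverse, and $\mathrm{bcirc}(\mathcal A)\in\mathbb C^{mp\times np}$ is the block circulant matrix whose $(a,b)$ block is $A^{(((a-b)\bmod p)+1)}$. For $\mathcal B\in\mathbb C^{n\times s\times p}$ the T-product is $\mathcal A*\mathcal B=\mathrm{fold}(\mathrm{bcirc}(\mathcal A)\,\mathrm{unfold}(\mathcal B))\in\mathbb C^{m\times s\times p}$. Block tensor: for $\mathcal A\in\mathbb C^{n_1\times m_1\times p}$, $\mathcal B\in\mathbb C^{n_1\times m_2\times p}$, $\mathcal C\in\mathbb C^{n_2\times m_1\times p}$, $\mathcal D\in\mathbb C^{n_2\times m_2\times p}$, the block tensor $\begin{bmatrix}\mathcal A&\mathcal B\\ \mathcal C&\mathcal D\end{bmatrix}\in\mathbb C^{(n_1+n_2)\times(m_1+m_2)\times p}$ is the tensor whose $k$-th frontal slice is $\begin{bmatrix}A^{(k)}&B^{(k)}\\ C^{(k)}&D^{(k)}\end{bmatrix}$, $k=1,\dots,p$. *)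

theory Defs
  imports "Jordan_Normal_Form.Matrix"
begin

text \<open>A third-order tensor of size \<open>m \<times> n \<times> p\<close> is the list of its \<open>p\<close> frontal slices, so the
  slice \<open>A\<^sup>(\<^sup>k\<^sup>)\<close> is \<open>A ! (k - 1)\<close>. All slice, row, column and block indices below start at 0.
  The empty list stands for every tensor with \<open>p = 0\<close>.\<close>

type_synonym 'a tensor = "'a mat list"

definition carrier_tensor :: "nat \<Rightarrow> nat \<Rightarrow> nat \<Rightarrow> 'a tensor set" where
  "carrier_tensor m n p = {A. length A = p \<and> set A \<subseteq> carrier_mat m n}"

definition slice_rows :: "'a tensor \<Rightarrow> nat" where
  "slice_rows A = dim_row (hd A)"

definition slice_cols :: "'a tensor \<Rightarrow> nat" where
  "slice_cols A = dim_col (hd A)"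

definition tensor_unfold :: "'a tensor \<Rightarrow> 'a mat" where
  "tensor_unfold A = (let m = slice_rows A in
     mat (m * length A) (slice_cols A) (\<lambda>(i, j). (A ! (i div m)) $$ (i mod m, j)))"

definition tensor_fold :: "nat \<Rightarrow> 'a mat \<Rightarrow> 'a tensor" where
  "tensor_fold p M = (let m = dim_row M div p in
     map (\<lambda>k. mat m (dim_col M) (\<lambda>(i, j). M $$ (k * m + i, j))) [0..<p])"

text \<open>The residue is taken over the integers, since block differences may be negative.\<close>

definition bcirc :: "'a tensor \<Rightarrow> 'a mat" where
  "bcirc A = (let m = slice_rows A; n = slice_cols A; p = length A in
     mat (m * p) (n * p) (\<lambda>(i, j).
       (A ! nat ((int (i div m) - int (j div n)) mod int p)) $$ (i mod m, j mod n)))"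

definition tensor_prod :: "'a :: semiring_0 tensor \<Rightarrow> 'a tensor \<Rightarrow> 'a tensor" (infixl "*\<^sub>t" 70) where
  "A *\<^sub>t B = tensor_fold (length A) (bcirc A * tensor_unfold B)"

definition tensor_add :: "'a :: plus tensor \<Rightarrow> 'a tensor \<Rightarrow> 'a tensor" (infixl "+\<^sub>t" 65) where
  "A +\<^sub>t B = map2 (+) A B"

definition block_tensor :: "'a :: zero tensor \<Rightarrow> 'a tensor \<Rightarrow> 'a tensor \<Rightarrow> 'a tensor \<Rightarrow> 'a tensor" where
  "block_tensor A B C D =
     map (\<lambda>k. four_block_mat (A ! k) (B ! k) (C ! k) (D ! k)) [0..<length A]"

lemma carrier_tensorD:
  assumes "A \<in> carrier_tensor m n p"
  shows "length A = p" and "k < p \<Longrightarrow> A ! k \<in> carrier_mat m n"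
    and "0 < p \<Longrightarrow> slice_rows A = m" and "0 < p \<Longrightarrow> slice_cols A = n"
proof -
  show l: "length A = p" using assms by (simp add: carrier_tensor_def)
  show k: "A ! k \<in> carrier_mat m n" if "k < p" for k
    using assms that by (auto simp: carrier_tensor_def)
  have "hd A = A ! 0" if "0 < p" using that l by (intro hd_conv_nth) auto
  then show "0 < p \<Longrightarrow> slice_rows A = m" "0 < p \<Longrightarrow> slice_cols A = n"
    using k[of 0] by (auto simp: slice_rows_def slice_cols_def)
qed

lemma block_index_less: "k * m + i < m * p" if "k < p" "i < m" for k m i p :: nat
proof -
  have "k * m + i < Suc k * m" using that by simp
  also have "\<dots> \<le> p * m" using that by (intro mult_le_mono1) simp
  finally show ?thesis by (simp add: mult.commute)
qed

lemma tensor_unfold_carrier: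
  assumes "A \<in> carrier_tensor m n p" and "0 < p"
  shows "tensor_unfold A \<in> carrier_mat (m * p) n"
  using carrier_tensorD[OF assms(1)] assms(2) by (simp add: tensor_unfold_def Let_def)

lemma tensor_fold_unfold:
  assumes A: "A \<in> carrier_tensor m n p" and p: "0 < p"
  shows "tensor_fold p (tensor_unfold A) = A"
proof (rule nth_equalityI)
  note D = carrier_tensorD[OF A]
  show "length (tensor_fold p (tensor_unfold A)) = length A"
    using D(1) by (simp add: tensor_fold_def Let_def)
  fix k assume "k < length (tensor_fold p (tensor_unfold A))"
  then have k: "k < p" by (simp add: tensor_fold_def Let_def)
  show "tensor_fold p (tensor_unfold A) ! k = A ! k"
    using D(1) D(2)[OF k] D(3,4)[OF p] k p
    by (intro eq_matI) (auto simp: tensor_fold_def tensor_unfold_def Let_def block_index_less)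
qed

lemma tensor_unfold_fold:
  assumes M: "M \<in> carrier_mat (m * p) n" and p: "0 < p"
  shows "tensor_fold p M \<in> carrier_tensor m n p" and "tensor_unfold (tensor_fold p M) = M"
proof -
  show C: "tensor_fold p M \<in> carrier_tensor m n p"
    using M p by (auto simp: tensor_fold_def carrier_tensor_def Let_def)
  show "tensor_unfold (tensor_fold p M) = M"
  proof (rule eq_matI)
    show "dim_row (tensor_unfold (tensor_fold p M)) = dim_row M"
      "dim_col (tensor_unfold (tensor_fold p M)) = dim_col M"
      using tensor_unfold_carrier[OF C p] M by auto
    fix i j assume "i < dim_row M" "j < dim_col M"
    then have i: "i < m * p" and j: "j < n" using M by auto
    then have "0 < m" by (cases m) auto
    moreover have "i div m < p" using i by (simp add: less_mult_imp_div_less mult.commute)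
    ultimately show "tensor_unfold (tensor_fold p M) $$ (i, j) = M $$ (i, j)"
      using M i j p carrier_tensorD[OF C]
      by (simp add: tensor_unfold_def Let_def) (simp add: tensor_fold_def Let_def)
  qed
qed

lemma bcirc_block:
  assumes A: "A \<in> carrier_tensor m n p" and "a < p" "b < p" "i < m" "j < n"
  shows "bcirc A $$ (a * m + i, b * n + j) = (A ! nat ((int a - int b) mod int p)) $$ (i, j)"
  using carrier_tensorD[OF A] assms by (simp add: bcirc_def Let_def block_index_less)

end

(* A slice of a T-product is the circular convolution of the slices of the factors, so the
   claim reduces slice by slice to the product rule for 2 x 2 block matrices. *)
theory Submission
  imports Defs
begin

text \<open>Multiplying by a block circulant matrix is circular convolution of slices: slice k of a
  T-product is the sum over l of slice (k - l) mod p of the left factor times slice l of the right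
  factor (\<open>tensor_prod_index\<close>). Block tensors are formed slice by slice, so for two of
  them every summand is a product of 2 x 2 block matrices, and \<open>mult_four_block_mat\<close>
  expands it. Each block of that product is a sum of two matrix products at the same pair of slices;
  summing over l turns it into a sum of two T-products (\<open>tensor_prod_add_index\<close>), which
  is the required block.\<close>

lemma sum_lessThan_mult:
  fixes f :: "nat \<Rightarrow> 'a :: comm_monoid_add"
  shows "(\<Sum>x < n * p. f x) = (\<Sum>l<p. \<Sum>q<n. f (l * n + q))"
proof -
  have "(\<Sum>x < n * p. f x) = (\<Sum>l<p. sum f {l * n ..< l * n + n})"
    using sum.nat_group[of f n p] by (simp add: mult.commute)
  also have "\<dots> = (\<Sum>l<p. \<Sum>q<n. f (l * n + q))"
    using sum.shift_bounds_nat_ivl[of f 0 "l * n" n for l]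
    by (simp add: atLeast0LessThan add.commute)
  finally show ?thesis .
qed

lemma bcirc_carrier:
  assumes "A \<in> carrier_tensor m n p" "0 < p"
  shows "bcirc A \<in> carrier_mat (m * p) (n * p)"
  using carrier_tensorD[OF assms(1)] assms(2) by (simp add: bcirc_def Let_def)

text \<open>Slice dimensions are read off the head of the list, so p = 0 is treated apart: there the
  product is the empty list.\<close>

lemma tensor_prod_carrier:
  assumes A: "A \<in> carrier_tensor m n p" and B: "B \<in> carrier_tensor n s p"
  shows "A *\<^sub>t B \<in> carrier_tensor m s p"
proof (cases "p = 0")
  case True
  then show ?thesis
    using carrier_tensorD(1)[OF A] by (simp add: tensor_prod_def tensor_fold_def carrier_tensor_def)
next
  case False
  then have p: "0 < p" by simp
  have "bcirc A * tensor_unfold B \<in> carrier_mat (m * p) s"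
    using bcirc_carrier[OF A p] tensor_unfold_carrier[OF B p] by simp
  then show ?thesis
    using tensor_unfold_fold(1)[OF _ p] carrier_tensorD(1)[OF A] by (simp add: tensor_prod_def)
qed

lemma tensor_prod_index:
  assumes A: "A \<in> carrier_tensor m n p" and B: "B \<in> carrier_tensor n s p"
    and k: "k < p" and i: "i < m" and j: "j < s"
  shows "((A *\<^sub>t B) ! k) $$ (i, j) =
    (\<Sum>l<p. (A ! nat ((int k - int l) mod int p) * B ! l) $$ (i, j))"
proof -
  let ?c = "\<lambda>l. nat ((int k - int l) mod int p)"
  have p: "0 < p" using k by simp
  note DA = carrier_tensorD[OF A] and DB = carrier_tensorD[OF B]
  have bA: "bcirc A \<in> carrier_mat (m * p) (n * p)"
    using bcirc_carrier[OF A p] .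
  have uB: "tensor_unfold B \<in> carrier_mat (n * p) s"
    using tensor_unfold_carrier[OF B p] .
  have ki: "k * m + i < m * p" using block_index_less[OF k i] .
  have unfold_ix: "tensor_unfold B $$ (l * n + q, j) = B ! l $$ (q, j)"
    if "l < p" "q < n" for l q
    using that DB p j by (simp add: tensor_unfold_def Let_def block_index_less)
  \<comment> \<open>The integer residue lies in [0, p) even when k < l, so \<open>?c l\<close> is a
    valid slice index.\<close>
  have c: "?c l < p" for l
    using p by (simp add: nat_less_iff)
  have "((A *\<^sub>t B) ! k) $$ (i, j) = (bcirc A * tensor_unfold B) $$ (k * m + i, j)"
    using DA(1) bA uB k i j p by (simp add: tensor_prod_def tensor_fold_def Let_def)
  also have "\<dots> = (\<Sum>x < n * p. bcirc A $$ (k * m + i, x) * tensor_unfold B $$ (x, j))"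
    using bA uB ki j by (simp add: scalar_prod_def atLeast0LessThan)
  also have "\<dots> = (\<Sum>l<p. \<Sum>q<n. A ! ?c l $$ (i, q) * B ! l $$ (q, j))"
    \<comment> \<open>Writing x = l * n + q separates the block column l of \<open>bcirc A\<close>,
      which meets slice l of \<open>B\<close>, from the position q inside the block.\<close>
    unfolding sum_lessThan_mult
    by (intro sum.cong refl) (simp add: bcirc_block[OF A k _ i] unfold_ix)
  also have "\<dots> = (\<Sum>l<p. (A ! ?c l * B ! l) $$ (i, j))"
  proof (intro sum.cong refl)
    fix l assume "l \<in> {..<p}"
    then show "(\<Sum>q<n. A ! ?c l $$ (i, q) * B ! l $$ (q, j)) = (A ! ?c l * B ! l) $$ (i, j)"
      using DA(2)[OF c[of l]] DB(2)[of l] i j by (simp add: scalar_prod_def atLeast0LessThan)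
  qed
  finally show ?thesis .
qed

lemma tensor_add_nth:
  assumes "A \<in> carrier_tensor m n p" "B \<in> carrier_tensor m n p" "k < p"
  shows "(A +\<^sub>t B) ! k = A ! k + B ! k"
  using carrier_tensorD(1)[OF assms(1)] carrier_tensorD(1)[OF assms(2)] assms(3)
  by (simp add: tensor_add_def)

lemma tensor_add_carrier:
  assumes A: "A \<in> carrier_tensor m n p" and B: "B \<in> carrier_tensor m n p"
  shows "A +\<^sub>t B \<in> carrier_tensor m n p"
proof -
  have "length (A +\<^sub>t B) = p"
    using carrier_tensorD(1)[OF A] carrier_tensorD(1)[OF B] by (simp add: tensor_add_def)
  moreover have "(A +\<^sub>t B) ! k \<in> carrier_mat m n" if "k < p" for k
    using tensor_add_nth[OF A B that] carrier_tensorD(2)[OF A that] carrier_tensorD(2)[OF B that]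
    by simp
  ultimately show ?thesis
    by (auto simp: carrier_tensor_def in_set_conv_nth)
qed

lemma block_tensor_nth:
  "k < length A \<Longrightarrow> block_tensor A B C D ! k = four_block_mat (A ! k) (B ! k) (C ! k) (D ! k)"
  by (simp add: block_tensor_def)

text \<open>The size of a \<open>four_block_mat\<close> comes from its diagonal blocks, hence
  assumptions on \<open>A\<close> and \<open>D\<close> only.\<close>

lemma block_tensor_carrier:
  assumes A: "A \<in> carrier_tensor n1 m1 p" and D: "D \<in> carrier_tensor n2 m2 p"
  shows "block_tensor A B C D \<in> carrier_tensor (n1 + n2) (m1 + m2) p"
  using carrier_tensorD(1,2)[OF A] carrier_tensorD(2)[OF D]
  by (auto simp: block_tensor_def carrier_tensor_def)

text \<open>Both convolutions pair the same slice indices for each l, so they merge term by term,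
  even with different inner dimensions n and n'. The summands then have the shape of a block in a
  product of 2 x 2 block matrices.\<close>

lemma tensor_prod_add_index:
  assumes A: "A \<in> carrier_tensor m n p" and A': "A' \<in> carrier_tensor n s p"
    and B: "B \<in> carrier_tensor m n' p" and B': "B' \<in> carrier_tensor n' s p"
    and k: "k < p" and i: "i < m" and j: "j < s"
  shows "((A *\<^sub>t A' +\<^sub>t B *\<^sub>t B') ! k) $$ (i, j) =
    (\<Sum>l<p. (A ! nat ((int k - int l) mod int p) * A' ! l
          + B ! nat ((int k - int l) mod int p) * B' ! l) $$ (i, j))"
proof -
  note P = tensor_prod_carrier[OF A A'] and Q = tensor_prod_carrier[OF B B']
  have c: "nat ((int k - int l) mod int p) < p" for l
    using k by (simp add: nat_less_iff)
  have "((A *\<^sub>t A' +\<^sub>t B *\<^sub>t B') ! k) $$ (i, j) =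
      ((A *\<^sub>t A') ! k) $$ (i, j) + ((B *\<^sub>t B') ! k) $$ (i, j)"
    unfolding tensor_add_nth[OF P Q k]
    using carrier_tensorD(2)[OF P k] carrier_tensorD(2)[OF Q k] i j by simp
  also have "\<dots> = (\<Sum>l<p. (A ! nat ((int k - int l) mod int p) * A' ! l) $$ (i, j)
      + (B ! nat ((int k - int l) mod int p) * B' ! l) $$ (i, j))"
    unfolding tensor_prod_index[OF A A' k i j] tensor_prod_index[OF B B' k i j]
    by (simp add: sum.distrib)
  also have "\<dots> = (\<Sum>l<p. (A ! nat ((int k - int l) mod int p) * A' ! l
          + B ! nat ((int k - int l) mod int p) * B' ! l) $$ (i, j))"
  proof (intro sum.cong refl)
    fix l assume "l \<in> {..<p}"
    then have l: "l < p" by simp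
    show "(A ! nat ((int k - int l) mod int p) * A' ! l) $$ (i, j)
        + (B ! nat ((int k - int l) mod int p) * B' ! l) $$ (i, j)
      = (A ! nat ((int k - int l) mod int p) * A' ! l
        + B ! nat ((int k - int l) mod int p) * B' ! l) $$ (i, j)"
      using carrier_tensorD(2)[OF A c[of l]] carrier_tensorD(2)[OF B c[of l]]
        carrier_tensorD(2)[OF A' l] carrier_tensorD(2)[OF B' l] i j
      by simp
  qed
  finally show ?thesis .
qed

theorem theorem7:
  fixes A1 B1 C1 D1 A2 B2 C2 D2 :: "complex tensor"
    and n1 n2 m1 m2 r1 r2 p :: nat
  assumes "A1 \<in> carrier_tensor n1 m1 p" and "B1 \<in> carrier_tensor n1 m2 p"
    and "C1 \<in> carrier_tensor n2 m1 p" and "D1 \<in> carrier_tensor n2 m2 p"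
    and "A2 \<in> carrier_tensor m1 r1 p" and "B2 \<in> carrier_tensor m1 r2 p"
    and "C2 \<in> carrier_tensor m2 r1 p" and "D2 \<in> carrier_tensor m2 r2 p"
  shows "block_tensor A1 B1 C1 D1 *\<^sub>t block_tensor A2 B2 C2 D2 =
    block_tensor (A1 *\<^sub>t A2 +\<^sub>t B1 *\<^sub>t C2) (A1 *\<^sub>t B2 +\<^sub>t B1 *\<^sub>t D2)
                 (C1 *\<^sub>t A2 +\<^sub>t D1 *\<^sub>t C2) (C1 *\<^sub>t B2 +\<^sub>t D1 *\<^sub>t D2)"
    (is "?X *\<^sub>t ?Y = block_tensor ?P ?Q ?R ?S")
proof (rule nth_equalityI)
  note h = assms
  note X = block_tensor_carrier[OF h(1) h(4), of B1 C1]
  note Y = block_tensor_carrier[OF h(5) h(8), of B2 C2]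
  note XY = tensor_prod_carrier[OF X Y]
  have P: "?P \<in> carrier_tensor n1 r1 p" and S: "?S \<in> carrier_tensor n2 r2 p"
    using h by (auto intro!: tensor_add_carrier tensor_prod_carrier)
  note PS = block_tensor_carrier[OF P S, of ?Q ?R]
  \<comment> \<open>Both lengths are p. For p = 0 no slice remains to be compared; otherwise any
    index k < p supplies p > 0.\<close>
  show "length (?X *\<^sub>t ?Y) = length (block_tensor ?P ?Q ?R ?S)"
    using carrier_tensorD(1)[OF XY] carrier_tensorD(1)[OF PS] by simp
  fix k assume "k < length (?X *\<^sub>t ?Y)"
  then have k: "k < p" using carrier_tensorD(1)[OF XY] by simp
  let ?c = "\<lambda>l. nat ((int k - int l) mod int p)"
  have c: "?c l < p" for l
    using k by (simp add: nat_less_iff)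
  note Pk = carrier_tensorD(2)[OF P k] and Sk = carrier_tensorD(2)[OF S k]
  show "(?X *\<^sub>t ?Y) ! k = block_tensor ?P ?Q ?R ?S ! k"
  proof (rule eq_matI)
    show "dim_row ((?X *\<^sub>t ?Y) ! k) = dim_row (block_tensor ?P ?Q ?R ?S ! k)"
      "dim_col ((?X *\<^sub>t ?Y) ! k) = dim_col (block_tensor ?P ?Q ?R ?S ! k)"
      using carrier_tensorD(2)[OF XY k] carrier_tensorD(2)[OF PS k] by auto
    fix i j
    assume "i < dim_row (block_tensor ?P ?Q ?R ?S ! k)" "j < dim_col (block_tensor ?P ?Q ?R ?S ! k)"
    then have i: "i < n1 + n2" and j: "j < r1 + r2"
      using carrier_tensorD(2)[OF PS k] by auto
    have slice: "(?X ! ?c l * ?Y ! l) $$ (i, j) =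
        (if i < n1 then
           if j < r1 then (A1 ! ?c l * A2 ! l + B1 ! ?c l * C2 ! l) $$ (i, j)
           else (A1 ! ?c l * B2 ! l + B1 ! ?c l * D2 ! l) $$ (i, j - r1)
         else if j < r1 then (C1 ! ?c l * A2 ! l + D1 ! ?c l * C2 ! l) $$ (i - n1, j)
         else (C1 ! ?c l * B2 ! l + D1 ! ?c l * D2 ! l) $$ (i - n1, j - r1))"
      if l: "l < p" for l
    proof -
      note L = h[THEN carrier_tensorD(2)]
      have "?X ! ?c l * ?Y ! l =
        four_block_mat (A1 ! ?c l * A2 ! l + B1 ! ?c l * C2 ! l)
          (A1 ! ?c l * B2 ! l + B1 ! ?c l * D2 ! l)
          (C1 ! ?c l * A2 ! l + D1 ! ?c l * C2 ! l)
          (C1 ! ?c l * B2 ! l + D1 ! ?c l * D2 ! l)"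
        using mult_four_block_mat[OF L(1)[OF c] L(2)[OF c] L(3)[OF c] L(4)[OF c]
            L(5)[OF l] L(6)[OF l] L(7)[OF l] L(8)[OF l]]
          carrier_tensorD(1)[OF h(1)] carrier_tensorD(1)[OF h(5)] c l
        by (simp add: block_tensor_nth)
      then show ?thesis
        \<comment> \<open>A matrix sum takes its dimensions from its second summand, so the block
          boundaries n1 and r1 come from \<open>B1\<close> and \<open>C2\<close>, and the sizes of
          the lower right block from \<open>D1\<close> and \<open>D2\<close>.\<close>
        using i j L(2)[OF c[of l]] L(4)[OF c[of l]] L(7)[OF l] L(8)[OF l] by simp
    qed
    have "((?X *\<^sub>t ?Y) ! k) $$ (i, j) = (\<Sum>l<p. (?X ! ?c l * ?Y ! l) $$ (i, j))"
      by (rule tensor_prod_index[OF X Y k i j])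
    \<comment> \<open>Which block holds the entry depends on i and j but not on l, so the case
      distinction can be pulled out of the sum; each case is then one convolution identity, at
      indices shifted by n1 and r1 where needed.\<close>
    also have "\<dots> = (if i < n1 then
           if j < r1 then (?P ! k) $$ (i, j) else (?Q ! k) $$ (i, j - r1)
         else if j < r1 then (?R ! k) $$ (i - n1, j) else (?S ! k) $$ (i - n1, j - r1))"
      using i j
        tensor_prod_add_index[OF h(1) h(5) h(2) h(7) k, of i j]
        tensor_prod_add_index[OF h(1) h(6) h(2) h(8) k, of i "j - r1"]
        tensor_prod_add_index[OF h(3) h(5) h(4) h(7) k, of "i - n1" j]
        tensor_prod_add_index[OF h(3) h(6) h(4) h(8) k, of "i - n1" "j - r1"]
      by (simp add: slice)
    also have "\<dots> = (block_tensor ?P ?Q ?R ?S ! k) $$ (i, j)"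
      using i j k Pk Sk carrier_tensorD(1)[OF P] by (simp add: block_tensor_nth)
    finally show "((?X *\<^sub>t ?Y) ! k) $$ (i, j) = (block_tensor ?P ?Q ?R ?S ! k) $$ (i, j)" .
  qed
qed

end
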